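(* Let $\beta\in\mathbb{C}$, and consider functions of the form $\tau(k,m)=\delta_{k+m,0}f(k)$ ($k,m\in\mathbb{Z}$), where $f$ is a polynomial with complex coefficients. The following are non-trivial delta cocycles: (1) $\delta_{k+m,0}$, when $\beta=1$; (2) $\delta_{k+m,0}\,k$, when $\beta=1$; (3) $\delta_{k+m,0}\,k^2$, when $\beta=0$; (4) $\delta_{k+m,0}\,k^3$, when $\beta=-1$. Moreover, every delta cocycle for $\beta$ is, modulo trivial ones, a linear combination of the cocycles listed for that value of $\beta$; in particular, if $\beta\notin\{1,0,-1\}$ every delta cocycle is trivial.
   Context: $W_1$ is the Witt algebra over $\mathbb{C}$ with basis $\{e_k:k\in\mathbb{Z}\}$ and $[e_k,e_s]=(s-k)e_{k+s}$. $T(\beta,0)$ has basis $\{w_m:m\in\mathbb{Z}\}$ with $e_kw_m=(m+\beta k)w_{m+k}$, and $D(0)=\mathbb{C}v_0$ is the trivial one-dimensional submodule of $T(0,0)$. Extensions $0\to D(0)\to M\to T(\beta,0)\to0$ are described by $e_kw_m=(m+\beta k)w_{m+k}+\delta_{k+m,0}f(k)v_0$. For $f$ polynomial, $\tau(k,m)=\delta_{k+m,0}f(k)$ is called a delta cocycle for $\beta$ if, for all $k,s\in\mathbb{Z}$, $$(s-k)f(k+s)=((\beta-1)s-k)f(k)-((\beta-1)k-s)f(s).$$ A delta cocycle is trivial if it is a scalar multiple of $k(1-\beta)\delta_{k+m,0}$ (the coboundary arising from the change of basis $w_m\mapsto w_m+c\,\delta_{m,0}v_0$). *)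

theory Defs
  imports "HOL-Computational_Algebra.Polynomial" Complex_Main
begin

definition delta_fun :: "(int \<Rightarrow> complex) \<Rightarrow> int \<Rightarrow> int \<Rightarrow> complex" where
  "delta_fun f k m = (if k + m = 0 then f k else 0)"

(* This is the v_0-component of [e_k, e_s] w_m = (s - k) e_(k+s) w_m at m = -(k + s), for the
   action e_k w_m = (m + \<beta> k) w_(m+k) + \<tau> k m v_0 with e_k v_0 = 0 and \<tau> = delta_fun f. *)
definition delta_cocycle_eq :: "complex \<Rightarrow> (int \<Rightarrow> complex) \<Rightarrow> bool" where
  "delta_cocycle_eq \<beta> f \<longleftrightarrow>
     (\<forall>k s :: int. (of_int s - of_int k) * f (k + s) =
        ((\<beta> - 1) * of_int s - of_int k) * f k - ((\<beta> - 1) * of_int k - of_int s) * f s)"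

definition delta_cocycle :: "complex \<Rightarrow> (int \<Rightarrow> int \<Rightarrow> complex) \<Rightarrow> bool" where
  "delta_cocycle \<beta> \<tau> \<longleftrightarrow>
     (\<exists>p :: complex poly. let f = (\<lambda>k. poly p (of_int k)) in
        \<tau> = delta_fun f \<and> delta_cocycle_eq \<beta> f)"

(* The coboundaries of w_m \<mapsto> w_m + c \<delta>_(m,0) v_0; only the zero function when \<beta> = 1. *)
definition trivial_delta_cocycle :: "complex \<Rightarrow> (int \<Rightarrow> int \<Rightarrow> complex) \<Rightarrow> bool" where
  "trivial_delta_cocycle \<beta> \<tau> \<longleftrightarrow>
     delta_cocycle \<beta> \<tau> \<and>
     (\<exists>c :: complex. \<tau> = (\<lambda>k m. c * delta_fun (\<lambda>j. of_int j * (1 - \<beta>)) k m))"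

definition nontrivial_delta_cocycle :: "complex \<Rightarrow> (int \<Rightarrow> int \<Rightarrow> complex) \<Rightarrow> bool" where
  "nontrivial_delta_cocycle \<beta> \<tau> \<longleftrightarrow> delta_cocycle \<beta> \<tau> \<and> \<not> trivial_delta_cocycle \<beta> \<tau>"

definition listed_cocycles :: "complex \<Rightarrow> (int \<Rightarrow> int \<Rightarrow> complex) set" where
  "listed_cocycles \<beta> =
     (if \<beta> = 1 then {delta_fun (\<lambda>k. 1), delta_fun (\<lambda>k. of_int k)}
      else if \<beta> = 0 then {delta_fun (\<lambda>k. of_int k ^ 2)}
      else if \<beta> = -1 then {delta_fun (\<lambda>k. of_int k ^ 3)}
      else {})"

end

theory Submission
  imports Defs
begin

text \<open>
  A solution \<open>f\<close> of the cocycle equation is controlled by its values at a few small integers.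
  Write \<open>b = \<beta> - 1\<close>, so that the equation is
  \<open>(s - k) f(k + s) = (b s - k) f(k) - (b k - s) f(s)\<close>. The function \<open>k\<close> solves it for every \<open>\<beta>\<close>,
  and is a coboundary unless \<open>\<beta> = 1\<close>. The constants solve it only when \<open>b = 0\<close>, and
  \<open>k = 0\<close> gives \<open>b f(0) = 0\<close>. After subtracting multiples of these solutions,
  \<open>f(0) = f(1) = 0\<close>, and what remains is governed by the single number \<open>f(2)\<close>.

  The equations with \<open>k = 1\<close> and \<open>k = 2\<close> propagate zeros in both directions, so that a solution
  vanishing at \<open>0, 1, 2\<close> is zero (\<open>delta_cocycle_eq_determined\<close>). On the other hand
  \<open>k = 1\<close> expresses \<open>f(3)\<close>, \<open>f(4)\<close>, \<open>f(5)\<close> through \<open>f(2)\<close>, and the equation at \<open>(k, s) = (2, 3)\<close>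
  computes \<open>f(5)\<close> a second time. The two values agree only if \<open>b (b + 1) (b + 2) f(2) = 0\<close>;
  the case \<open>b = 0\<close> is removed by the negative integers (\<open>delta_cocycle_eq_obstruction\<close>). So
  \<open>f(2)\<close> can be nonzero only for \<open>\<beta> = 0\<close> and \<open>\<beta> = -1\<close>, where \<open>k^2\<close> and \<open>k^3\<close> account for it.

  A coboundary is linear in \<open>k\<close>, and zero when \<open>\<beta> = 1\<close>; comparing values at \<open>1\<close> and \<open>2\<close> shows
  that the listed cocycles are not of this form.
\<close>

section \<open>Solutions of the cocycle equation\<close>

lemma delta_cocycle_eqD:
  assumes "delta_cocycle_eq \<beta> f"
  shows "(of_int s - of_int k) * f (k + s) =
    ((\<beta> - 1) * of_int s - of_int k) * f k - ((\<beta> - 1) * of_int k - of_int s) * f s"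
  using assms unfolding delta_cocycle_eq_def by blast

lemma delta_cocycle_eq_diff_scale:
  assumes f: "delta_cocycle_eq \<beta> f" and g: "delta_cocycle_eq \<beta> g"
  shows "delta_cocycle_eq \<beta> (\<lambda>k. f k - c * g k)"
  unfolding delta_cocycle_eq_def
proof (intro allI)
  fix k s :: int
  let ?x = "of_int s - of_int k :: complex"
  let ?y = "(\<beta> - 1) * of_int s - of_int k"
  let ?z = "(\<beta> - 1) * of_int k - of_int s"
  have "?x * (f (k + s) - c * g (k + s)) = ?x * f (k + s) - c * (?x * g (k + s))"
    by (simp only: right_diff_distrib mult.left_commute)
  also have "\<dots> = (?y * f k - ?z * f s) - c * (?y * g k - ?z * g s)"
    by (simp only: delta_cocycle_eqD[OF f, of s k] delta_cocycle_eqD[OF g, of s k])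
  also have "\<dots> = ?y * (f k - c * g k) - ?z * (f s - c * g s)"
    by (simp only: right_diff_distrib mult.left_commute) simp
  finally show "?x * (f (k + s) - c * g (k + s)) = \<dots>" .
qed

lemma delta_cocycle_eq_scaled_id: "delta_cocycle_eq \<beta> (\<lambda>k. c * of_int k)"
  by (simp add: delta_cocycle_eq_def algebra_simps)

lemma delta_cocycle_eq_id: "delta_cocycle_eq \<beta> of_int"
  using delta_cocycle_eq_scaled_id[of \<beta> 1] by simp

lemma delta_cocycle_eq_one: "delta_cocycle_eq 1 (\<lambda>k. 1)"
  by (simp add: delta_cocycle_eq_def)

lemma delta_cocycle_eq_square: "delta_cocycle_eq 0 (\<lambda>k. of_int k ^ 2)"
  by (simp add: delta_cocycle_eq_def algebra_simps power2_eq_square)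

lemma delta_cocycle_eq_cube: "delta_cocycle_eq (-1) (\<lambda>k. of_int k ^ 3)"
  by (simp add: delta_cocycle_eq_def algebra_simps power3_eq_cube)

lemma delta_cocycle_eq_zero:
  assumes "delta_cocycle_eq \<beta> f" and "\<beta> \<noteq> 1"
  shows "f 0 = 0"
  using delta_cocycle_eqD[OF assms(1), of 0 1] assms(2) by simp

section \<open>Uniqueness and the obstruction at 2\<close>

text \<open>
  The zero set is closed under steps in both directions. Upwards from \<open>2\<close>, the equation with
  \<open>k = 1\<close> is a recursion with nonzero leading factor \<open>s - 1\<close>. Downwards, its factor \<open>s - b\<close> may
  vanish, as may the factor \<open>s - 2 b\<close> of the equation with \<open>k = 2\<close>, but twice the former minus the
  latter is \<open>s\<close>, so they do not vanish together at a negative \<open>s\<close>.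
\<close>

lemma delta_cocycle_eq_determined:
  assumes f: "delta_cocycle_eq \<beta> f" and z: "f 0 = 0" "f 1 = 0" "f 2 = 0"
  shows "f k = 0"
proof -
  have up: "f (2 + int n) = 0" for n
  proof (induction n)
    case 0
    show ?case using z by simp
  next
    case (Suc n)
    have "(of_nat n + 1 :: complex) * f (3 + int n) = 0"
      using delta_cocycle_eqD[OF f, of "2 + int n" 1] Suc z by (simp add: add.commute)
    moreover have "(of_nat n + 1 :: complex) \<noteq> 0"
      by (metis of_nat_Suc of_nat_neq_0 add.commute)
    ultimately show ?case by (simp add: add.commute)
  qed
  have down: "f (- int n) = 0 \<and> f (1 - int n) = 0" for n
  proof (induction n)
    case 0
    show ?case using z by simp
  next
    case (Suc n)
    define s where "s = - int (Suc n)"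
    have s: "1 + s = - int n" "2 + s = 1 - int n" "s \<noteq> 0" by (simp_all add: s_def)
    have e1: "(of_int s - (\<beta> - 1)) * f s = 0"
      using delta_cocycle_eqD[OF f, of s 1] Suc z s by (auto simp: algebra_simps)
    have e2: "(of_int s - 2 * (\<beta> - 1)) * f s = 0"
      using delta_cocycle_eqD[OF f, of s 2] Suc z s by (auto simp: mult.commute)
    have "of_int s * f s = 2 * ((of_int s - (\<beta> - 1)) * f s) - (of_int s - 2 * (\<beta> - 1)) * f s"
      by (simp add: algebra_simps)
    then have "of_int s * f s = 0" unfolding e1 e2 by simp
    then have "f s = 0" using s(3) by simp
    then show ?case using Suc s by (simp add: s_def)
  qed
  consider "k = 1" | "k \<ge> 2" | "k \<le> 0" by linarith
  then show ?thesis
  proof cases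
    case 1
    then show ?thesis using z by simp
  next
    case 2
    then show ?thesis using up[of "nat (k - 2)"] by simp
  next
    case 3
    then show ?thesis using down[of "nat (- k)"] by simp
  qed
qed

text \<open>
  The values at positive integers alone give \<open>b (b + 1) (b + 2) f(2) = 0\<close>: they cannot exclude
  \<open>b = 0\<close>, since \<open>f(s) = s - 1\<close> for positive \<open>s\<close> is consistent there. In that case the pairs
  \<open>(1, -1)\<close> and \<open>(2, -1)\<close> force \<open>f(-1) = 0\<close> and then \<open>f(2) = 0\<close>.
\<close>

lemma delta_cocycle_eq_obstruction:
  assumes f: "delta_cocycle_eq \<beta> f" and z: "f 0 = 0" "f 1 = 0"
  shows "\<beta> * (\<beta> + 1) * f 2 = 0"
proof (cases "\<beta> = 1")
  case True
  have "f (-1) = 0"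
    using delta_cocycle_eqD[OF f, of "-1" 1] z True by simp
  then show ?thesis
    using delta_cocycle_eqD[OF f, of "-1" 2] z True by simp
next
  case False
  have f3: "f 3 = (3 - \<beta>) * f 2"
    using delta_cocycle_eqD[OF f, of 2 1] z by (simp add: algebra_simps)
  have f4: "2 * f 4 = (4 - \<beta>) * f 3"
    using delta_cocycle_eqD[OF f, of 3 1] z by (simp add: algebra_simps)
  have f5: "3 * f 5 = (5 - \<beta>) * f 4"
    using delta_cocycle_eqD[OF f, of 4 1] z by (simp add: algebra_simps)
  have f5': "f 5 = (3 * \<beta> - 5) * f 2 - (2 * \<beta> - 5) * f 3"
    using delta_cocycle_eqD[OF f, of 3 2] by (simp add: algebra_simps)
  have "(\<beta> - 1) * (\<beta> * (\<beta> + 1) * f 2) = 0"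
    using f3 f4 f5 f5' by algebra
  then show ?thesis using False by simp
qed

section \<open>Classification of the solutions\<close>

lemma delta_cocycle_eq_classify_1:
  assumes f: "delta_cocycle_eq 1 f"
  shows "f k = f 0 + (f 1 - f 0) * of_int k"
proof -
  define g where "g = (\<lambda>k. (f k - f 0 * 1) - (f 1 - f 0) * of_int k)"
  have g: "delta_cocycle_eq 1 g"
    unfolding g_def
    by (intro delta_cocycle_eq_diff_scale f delta_cocycle_eq_one delta_cocycle_eq_id)
  have "g 0 = 0" "g 1 = 0" by (simp_all add: g_def)
  moreover have "g 2 = 0"
    using delta_cocycle_eq_obstruction[OF g] calculation by simp
  ultimately have "g k = 0" by (rule delta_cocycle_eq_determined[OF g])
  then show ?thesis by (simp add: g_def diff_eq_eq)
qed

text \<open>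
  A solution vanishing at \<open>0\<close> is determined by \<open>f(1)\<close> and \<open>f(2) - 2 f(1)\<close>. The latter vanishes
  for \<open>f(k) = k\<close>, so it fixes the coefficient of \<open>h\<close>, after which \<open>f(1)\<close> fixes that of \<open>k\<close>.
\<close>

lemma delta_cocycle_eq_classify_from:
  assumes f: "delta_cocycle_eq \<beta> f" and h: "delta_cocycle_eq \<beta> h"
    and "\<beta> \<noteq> 1" and "h 2 \<noteq> 2 * h 1"
  shows "\<exists>c d. \<forall>k. f k = c * of_int k + d * h k"
proof -
  define d where "d = (f 2 - 2 * f 1) / (h 2 - 2 * h 1)"
  define c where "c = f 1 - d * h 1"
  define g where "g = (\<lambda>k. (f k - d * h k) - c * of_int k)"
  have g: "delta_cocycle_eq \<beta> g"
    unfolding g_def by (intro delta_cocycle_eq_diff_scale f h delta_cocycle_eq_id)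
  have "d * (h 2 - 2 * h 1) = f 2 - 2 * f 1"
    using assms(4) by (simp add: d_def)
  then have "g 2 = 0" by (simp add: g_def c_def algebra_simps)
  moreover have "g 0 = 0" using delta_cocycle_eq_zero[OF g] assms(3) by simp
  moreover have "g 1 = 0" by (simp add: g_def c_def)
  ultimately have "g k = 0" for k using delta_cocycle_eq_determined[OF g] by blast
  then have "f k = c * of_int k + d * h k" for k
    by (simp add: g_def algebra_simps)
  then show ?thesis by blast
qed

lemma delta_cocycle_eq_classify_generic:
  assumes f: "delta_cocycle_eq \<beta> f" and "\<beta> \<notin> {1, 0, -1}"
  shows "f k = f 1 * of_int k"
proof -
  define g where "g = (\<lambda>k. f k - f 1 * of_int k)"
  have g: "delta_cocycle_eq \<beta> g"
    unfolding g_def by (intro delta_cocycle_eq_diff_scale f delta_cocycle_eq_id)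
  have z: "g 0 = 0" "g 1 = 0"
    using delta_cocycle_eq_zero[OF g] assms(2) by (simp_all add: g_def)
  have "\<beta> + 1 \<noteq> 0" using assms(2) by (simp add: add_eq_0_iff2)
  then have "g 2 = 0"
    using delta_cocycle_eq_obstruction[OF g z] assms(2) by simp
  then have "g k = 0" using delta_cocycle_eq_determined[OF g z] by blast
  then show ?thesis by (simp add: g_def)
qed

section \<open>Delta cocycles\<close>

lemma delta_cocycleE:
  assumes "delta_cocycle \<beta> \<tau>"
  obtains f where "\<tau> = delta_fun f" "delta_cocycle_eq \<beta> f"
  using assms unfolding delta_cocycle_def Let_def by blast

lemma delta_cocycleI:
  assumes "delta_cocycle_eq \<beta> f" and "\<And>k. f k = poly p (of_int k)"
  shows "delta_cocycle \<beta> (delta_fun f)"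
proof -
  have "f = (\<lambda>k. poly p (of_int k))" using assms(2) by blast
  then show ?thesis using assms(1) unfolding delta_cocycle_def Let_def by blast
qed

text \<open>For \<open>\<beta> = 1\<close> the coboundary map is zero, which forces \<open>c = 0\<close> there.\<close>

lemma trivial_delta_cocycle_linear:
  assumes "\<beta> = 1 \<longrightarrow> c = 0"
  shows "trivial_delta_cocycle \<beta> (delta_fun (\<lambda>k. c * of_int k))"
proof -
  have "delta_cocycle \<beta> (delta_fun (\<lambda>k. c * of_int k))"
    by (rule delta_cocycleI[where p = "[:0, c:]"]) (simp_all add: delta_cocycle_eq_scaled_id)
  moreover have "delta_fun (\<lambda>k. c * of_int k) =
      (\<lambda>k m. c / (1 - \<beta>) * delta_fun (\<lambda>j. of_int j * (1 - \<beta>)) k m)"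
    using assms by (cases "\<beta> = 1") (auto simp: delta_fun_def fun_eq_iff)
  ultimately show ?thesis unfolding trivial_delta_cocycle_def by blast
qed

lemma nontrivial_delta_cocycleI:
  assumes "delta_cocycle_eq \<beta> f" and "\<And>k. f k = poly p (of_int k)"
    and "\<And>c. \<exists>k. f k \<noteq> c * (of_int k * (1 - \<beta>))"
  shows "nontrivial_delta_cocycle \<beta> (delta_fun f)"
proof -
  have "\<not> trivial_delta_cocycle \<beta> (delta_fun f)"
  proof
    assume "trivial_delta_cocycle \<beta> (delta_fun f)"
    then obtain c where c: "delta_fun f = (\<lambda>k m. c * delta_fun (\<lambda>j. of_int j * (1 - \<beta>)) k m)"
      unfolding trivial_delta_cocycle_def by blast
    have "f k = c * (of_int k * (1 - \<beta>))" for k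
      using fun_cong[OF fun_cong[OF c, of k], of "-k"] by (simp add: delta_fun_def)
    then show False using assms(3)[of c] by blast
  qed
  then show ?thesis
    using delta_cocycleI[OF assms(1,2)] unfolding nontrivial_delta_cocycle_def by blast
qed

lemma nontrivial_one: "nontrivial_delta_cocycle 1 (delta_fun (\<lambda>k. 1))"
  by (rule nontrivial_delta_cocycleI[where p = "[:1:]"]) (simp_all add: delta_cocycle_eq_one)

lemma nontrivial_id: "nontrivial_delta_cocycle 1 (delta_fun (\<lambda>k. of_int k))"
  by (rule nontrivial_delta_cocycleI[where p = "[:0, 1:]"])
    (auto simp: delta_cocycle_eq_id intro: exI[of _ 1])

lemma nontrivial_square: "nontrivial_delta_cocycle 0 (delta_fun (\<lambda>k. of_int k ^ 2))"
proof (rule nontrivial_delta_cocycleI[where p = "[:0, 0, 1:]"])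
  show "\<exists>k. (of_int k :: complex) ^ 2 \<noteq> c * (of_int k * (1 - 0))" for c
  proof (cases "c = 1")
    case True
    then show ?thesis by (intro exI[of _ 2]) simp
  next
    case False
    then show ?thesis by (intro exI[of _ 1]) simp
  qed
qed (simp_all add: delta_cocycle_eq_square, simp add: power2_eq_square)

lemma nontrivial_cube: "nontrivial_delta_cocycle (-1) (delta_fun (\<lambda>k. of_int k ^ 3))"
proof (rule nontrivial_delta_cocycleI[where p = "[:0, 0, 0, 1:]"])
  show "\<exists>k. (of_int k :: complex) ^ 3 \<noteq> c * (of_int k * (1 - (-1)))" for c
  proof (cases "c = 1 / 2")
    case True
    then show ?thesis by (intro exI[of _ 2]) auto
  next
    case False
    then show ?thesis by (intro exI[of _ 1]) (simp add: eq_divide_eq)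
  qed
qed (simp_all add: delta_cocycle_eq_cube, simp add: power3_eq_cube)

lemma delta_cocycle_trivial_generic:
  assumes "delta_cocycle \<beta> \<tau>" and "\<beta> \<notin> {1, 0, -1}"
  shows "trivial_delta_cocycle \<beta> \<tau>"
proof -
  obtain f where \<tau>: "\<tau> = delta_fun f" and f: "delta_cocycle_eq \<beta> f"
    using assms(1) by (rule delta_cocycleE)
  have "f = (\<lambda>k. f 1 * of_int k)"
    using delta_cocycle_eq_classify_generic[OF f assms(2)] by blast
  then show ?thesis
    using trivial_delta_cocycle_linear[of \<beta> "f 1"] assms(2) \<tau> by simp
qed

lemma delta_cocycle_decompose:
  assumes "delta_cocycle \<beta> \<tau>"
  shows "\<exists>\<sigma> a. trivial_delta_cocycle \<beta> \<sigma> \<and>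
    (\<forall>k m. \<tau> k m = \<sigma> k m + (\<Sum>\<rho>\<in>listed_cocycles \<beta>. a \<rho> * \<rho> k m))"
proof -
  obtain f where \<tau>: "\<tau> = delta_fun f" and f: "delta_cocycle_eq \<beta> f"
    using assms by (rule delta_cocycleE)
  have from_single: ?thesis
    if ne: "\<beta> \<noteq> 1" and L: "listed_cocycles \<beta> = {delta_fun h}"
      and h: "delta_cocycle_eq \<beta> h" "h 2 \<noteq> 2 * h 1" for h
  proof -
    obtain c d where fk: "\<And>k. f k = c * of_int k + d * h k"
      using delta_cocycle_eq_classify_from[OF f h(1) ne h(2)] by blast
    show ?thesis
    proof (intro exI conjI allI)
      show "trivial_delta_cocycle \<beta> (delta_fun (\<lambda>k. c * of_int k))"
        using trivial_delta_cocycle_linear ne by blast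
      show "\<tau> k m = delta_fun (\<lambda>k. c * of_int k) k m +
          (\<Sum>\<rho>\<in>listed_cocycles \<beta>. (\<lambda>_. d) \<rho> * \<rho> k m)" for k m
        by (simp add: \<tau> L delta_fun_def fk)
    qed
  qed
  consider "\<beta> = 1" | "\<beta> = 0" | "\<beta> = -1" | "\<beta> \<notin> {1, 0, -1}" by blast
  then show ?thesis
  proof cases
    case 1
    let ?one = "delta_fun (\<lambda>k. 1)" and ?id = "delta_fun (\<lambda>k. of_int k)"
    \<comment> \<open>The two listed cocycles differ at \<open>(0, 0)\<close>, so their coefficients can be chosen separately.\<close>
    have ne: "?one \<noteq> ?id"
      by (auto simp: delta_fun_def dest!: fun_cong[where x = 0])
    define a where "a = (\<lambda>\<rho>. if \<rho> = ?one then f 0 else f 1 - f 0)"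
    have fk: "f k = f 0 + (f 1 - f 0) * of_int k" for k
      using delta_cocycle_eq_classify_1 f 1 by blast
    have "\<tau> k m = delta_fun (\<lambda>k. 0 * of_int k) k m + (\<Sum>\<rho>\<in>listed_cocycles \<beta>. a \<rho> * \<rho> k m)"
      for k m
    proof -
      have "(\<Sum>\<rho>\<in>listed_cocycles \<beta>. a \<rho> * \<rho> k m) = f 0 * ?one k m + (f 1 - f 0) * ?id k m"
        using ne ne[symmetric] 1 by (simp add: listed_cocycles_def a_def)
      then show ?thesis using fk[of k] by (simp add: \<tau> delta_fun_def)
    qed
    then show ?thesis
      using trivial_delta_cocycle_linear[of \<beta> 0] by blast
  next
    case 2
    show ?thesis
      by (rule from_single[where h = "\<lambda>k. of_int k ^ 2"])
        (use 2 in \<open>simp_all add: listed_cocycles_def delta_cocycle_eq_square\<close>)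
  next
    case 3
    show ?thesis
      by (rule from_single[where h = "\<lambda>k. of_int k ^ 3"])
        (use 3 in \<open>simp_all add: listed_cocycles_def delta_cocycle_eq_cube\<close>)
  next
    case 4
    then have "listed_cocycles \<beta> = {}" by (simp add: listed_cocycles_def)
    then show ?thesis using delta_cocycle_trivial_generic[OF assms 4] by auto
  qed
qed

theorem mainTheorem3:
  fixes \<beta> :: complex
  shows "(\<beta> = 1 \<longrightarrow> nontrivial_delta_cocycle \<beta> (delta_fun (\<lambda>k. 1)))
    \<and> (\<beta> = 1 \<longrightarrow> nontrivial_delta_cocycle \<beta> (delta_fun (\<lambda>k. of_int k)))
    \<and> (\<beta> = 0 \<longrightarrow> nontrivial_delta_cocycle \<beta> (delta_fun (\<lambda>k. of_int k ^ 2)))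
    \<and> (\<beta> = -1 \<longrightarrow> nontrivial_delta_cocycle \<beta> (delta_fun (\<lambda>k. of_int k ^ 3)))
    \<and> (\<forall>\<tau>. delta_cocycle \<beta> \<tau> \<longrightarrow>
         (\<exists>\<sigma> a. trivial_delta_cocycle \<beta> \<sigma> \<and>
            (\<forall>k m. \<tau> k m = \<sigma> k m + (\<Sum>\<rho>\<in>listed_cocycles \<beta>. a \<rho> * \<rho> k m))))
    \<and> (\<beta> \<notin> {1, 0, -1} \<longrightarrow> (\<forall>\<tau>. delta_cocycle \<beta> \<tau> \<longrightarrow> trivial_delta_cocycle \<beta> \<tau>))"
  using nontrivial_one nontrivial_id nontrivial_square nontrivial_cube
    delta_cocycle_decompose delta_cocycle_trivial_generic by blast

end
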